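(* Let $\alpha$ be an arbitrary non-dyadic partition. If $x\in[0,1]$ is such that the derivative $\theta_\alpha'(x)$ exists in a generalised sense, then $\theta_\alpha'(x)\in\{0,\infty\}$.
   Context: $\mathbb N=\{1,2,3,\dots\}$, $\lambda$ is Lebesgue measure. Let $\alpha=\{A_n:n\in\mathbb N\}$ be a countably infinite partition of the unit interval (i.e. of $(0,1]$) into non-empty, left-open, right-closed intervals, ordered from right to left starting from $A_1$ and accumulating only at $0$. Put $a_n:=\lambda(A_n)$ and $t_n:=\sum_{k\ge n}a_k$, so $t_1=1$ and $A_n=(t_{n+1},t_n]$. The dyadic partition is $\{(2^{-n},2^{-(n-1)}]:n\in\mathbb N\}$; $\alpha$ is non-dyadic if it is not this partition. $\alpha$-Lüroth map: $L_\alpha(x)=(t_n-x)/a_n$ for $x\in A_n$, $L_\alpha(0)=0$. Each $x\in(0,1]$ has an $\alpha$-Lüroth expansion $x=[\ell_1,\ell_2,\dots]_\alpha:=\sum_{n\ge1}(-1)^{n-1}\bigl(\prod_{i<n}a_{\ell_i}\bigr)t_{\ell_n}$, where $L_\alpha^{k-1}(x)\in A_{\ell_k}$; the sequence is finite, terminating at index $k$, when $L_\alpha^{k-1}(x)=t_n$ for some $n\ge2$ (finite sum; also $1=[1]_\alpha$). Finite expansions are two-fold: $[\ell_1,\dots,\ell_k,1]_\alpha=[\ell_1,\dots,\ell_{k-1},\ell_k+1]_\alpha$; infinite expansions are unique. $\alpha$-Farey-Minkowski function: $\theta_\alpha:[0,1]\to[0,1]$, $\theta_\alpha(0)=0$ and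 $\theta_\alpha([\ell_1,\ell_2,\dots]_\alpha)=-2\sum_{k\ge1}(-1)^k2^{-\sum_{i=1}^k\ell_i}$ (finite sum for finite expansions); it is a strictly increasing homeomorphism of $[0,1]$. The derivative $\theta_\alpha'(x)$ "exists in a generalised sense" if the difference quotients at $x$ (one-sided at the endpoints of $[0,1]$) have a limit that is either finite or equal to $\infty$; in the latter case $\theta_\alpha'(x)=\infty$. *)

theory Defs
  imports "HOL-Analysis.Analysis"
begin

text \<open>
  A partition \<open>\<alpha> = {A\<^sub>1, A\<^sub>2, \<dots>}\<close> is given by the family \<open>A\<close> of its atoms, numbered from right to
  left.  Indices start at 1; the value \<open>A 0\<close> is irrelevant.
\<close>

definition luroth_partition :: "(nat \<Rightarrow> real set) \<Rightarrow> bool" where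
  "luroth_partition A \<longleftrightarrow>
     partition_on {0<..1} (A ` {1..}) \<and>
     (\<forall>n\<ge>1. \<exists>l r. l < r \<and> A n = {l<..r}) \<and>
     (\<forall>m n. 1 \<le> m \<and> m < n \<longrightarrow> (\<forall>x\<in>A m. \<forall>y\<in>A n. y < x)) \<and>
     (\<forall>p. p \<noteq> 0 \<longrightarrow> (\<exists>e>0. finite {n. 1 \<le> n \<and> A n \<inter> ball p e \<noteq> {}}))"

definition dyadic :: "(nat \<Rightarrow> real set) \<Rightarrow> bool" where
  "dyadic A \<longleftrightarrow> A ` {1..} = (\<lambda>n. {1 / 2 ^ n <.. 1 / 2 ^ (n - 1)}) ` {1..}"

definition luroth_width :: "(nat \<Rightarrow> real set) \<Rightarrow> nat \<Rightarrow> real" where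
  "luroth_width A n = measure lborel (A n)"

definition luroth_tail :: "(nat \<Rightarrow> real set) \<Rightarrow> nat \<Rightarrow> real" where
  "luroth_tail A n = (\<Sum>k. luroth_width A (n + k))"

definition luroth_index :: "(nat \<Rightarrow> real set) \<Rightarrow> real \<Rightarrow> nat" where
  "luroth_index A x = (THE n. 1 \<le> n \<and> x \<in> A n)"

definition luroth_map :: "(nat \<Rightarrow> real set) \<Rightarrow> real \<Rightarrow> real" where
  "luroth_map A x =
     (if x = 0 then 0
      else (luroth_tail A (luroth_index A x) - x) / luroth_width A (luroth_index A x))"

definition luroth_digit :: "(nat \<Rightarrow> real set) \<Rightarrow> real \<Rightarrow> nat \<Rightarrow> nat" where
  "luroth_digit A x k = luroth_index A ((luroth_map A ^^ (k - 1)) x)"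

text \<open>
  The index set of the expansion of \<open>x \<in> (0,1]\<close>, either \<open>{1..}\<close> or some \<open>{1..m}\<close>: the digit
  sequence stops at the first index \<open>j\<close> such that the \<open>(j-1)\<close>-st iterate of \<open>x\<close> is some \<open>t\<^sub>n\<close>.
  The value \<open>n = 1\<close> matters only for \<open>x = t\<^sub>1 = 1\<close>, whose expansion has the single digit 1.
\<close>

definition luroth_positions :: "(nat \<Rightarrow> real set) \<Rightarrow> real \<Rightarrow> nat set" where
  "luroth_positions A x =
     {k. 1 \<le> k \<and> (\<forall>j\<in>{1..<k}. \<forall>n\<ge>1. (luroth_map A ^^ (j - 1)) x \<noteq> luroth_tail A n)}"

lemma luroth_partition_atoms:
  assumes "luroth_partition A" and "1 \<le> n"
  shows "A n = {luroth_tail A (Suc n)<..luroth_tail A n}"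
    and "luroth_width A n = luroth_tail A n - luroth_tail A (Suc n)"
    and "0 < luroth_width A n" and "0 < luroth_tail A n" and "luroth_tail A 1 = 1"
proof -
  have part: "partition_on {0<..1} (A ` {1..})"
    and lr0: "\<forall>n\<ge>1. \<exists>l r. l < r \<and> A n = {l<..r}"
    and ord: "\<And>m n x y. 1 \<le> m \<Longrightarrow> m < n \<Longrightarrow> x \<in> A m \<Longrightarrow> y \<in> A n \<Longrightarrow> y < x"
    using assms(1) unfolding luroth_partition_def by blast+
  obtain l r where lr: "\<And>n. 1 \<le> n \<Longrightarrow> l n < r n \<and> A n = {l n<..r n}"
    using lr0 by metis
  have un: "(\<Union>n\<in>{1..}. A n) = {0<..1}"
    using part by (auto simp: partition_on_def)
  have rA: "r n \<in> A n" if "1 \<le> n" for n using lr[OF that] by auto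
  have bnd: "0 \<le> l n \<and> r n \<le> 1" if "1 \<le> n" for n
  proof -
    have "A n \<subseteq> {0<..1}" using un that by blast
    then have "{l n<..r n} \<subseteq> {0..1}" using lr[OF that] by auto
    then show ?thesis using lr[OF that] by (simp add: greaterThanAtMost_subseteq_atLeastAtMost_iff)
  qed
  have ordl: "r n \<le> l m" if "1 \<le> m" "m < n" for m n
  proof (rule dense_ge_bounded[of "l m" "r m"])
    show "l m < r m" using lr that by auto
    fix x assume "l m < x" "x < r m"
    then have "x \<in> A m" using lr[OF that(1)] by auto
    then show "r n \<le> x" using ord[OF that _ rA[of n]] that by (simp add: less_imp_le)
  qed
  have step: "r (Suc n) = l n" if n: "1 \<le> n" for n
  proof (rule ccontr)
    assume "r (Suc n) \<noteq> l n"
    then have lt: "r (Suc n) < l n" using ordl[of n "Suc n"] n by auto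
    have "l n \<in> {0<..1}" using lt lr[of "Suc n"] bnd[of "Suc n"] bnd[of n] lr[of n] n by auto
    then obtain m where m: "1 \<le> m" "l n \<in> A m" using un by blast
    then have lm: "l m < l n" "l n \<le> r m" using lr by auto
    consider "m < n" | "m = n" | "m = Suc n" | "Suc n < m" by linarith
    then show False
    proof cases
      case 1
      then show ?thesis using ordl[of m n] m lm lr[OF n] by auto
    next
      case 4
      then show ?thesis using ordl[of "Suc n" m] m lm lt lr[of "Suc n"] by auto
    qed (use lm lt in auto)
  qed
  have r1: "r 1 = 1"
  proof -
    have "(1::real) \<in> {0<..1}" by simp
    then obtain m where m: "1 \<le> m" "1 \<in> A m" using un by blast
    then have "1 \<le> r m" using lr by auto
    moreover have "r m < r 1" if "m \<noteq> 1" using ordl[of 1 m] lr[of 1] m that by auto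
    ultimately show ?thesis using bnd[of 1] by fastforce
  qed
  have lim: "l \<longlonglongrightarrow> 0"
  proof (rule LIMSEQ_I)
    fix e :: real assume "0 < e"
    then have "min e 1 \<in> {0<..1}" by auto
    then obtain m where m: "1 \<le> m" "min e 1 \<in> A m" using un by blast
    then have "l m < e" using lr[OF m(1)] by auto
    moreover have "l n \<le> l m" if "m \<le> n" for n
      using ordl[of m n] lr[of n] m that by (cases "m = n") auto
    ultimately have "norm (l n - 0) < e" if "m \<le> n" for n
      using bnd[OF order_trans[OF m(1) that]] that by (fastforce intro: le_less_trans)
    then show "\<exists>no. \<forall>n\<ge>no. norm (l n - 0) < e" by blast
  qed
  have width: "luroth_width A n = r n - r (Suc n)" if "1 \<le> n" for n
    using lr[OF that] step[OF that] by (simp add: luroth_width_def)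
  have tail: "luroth_tail A n = r n" if n: "1 \<le> n" for n
  proof -
    have "(\<lambda>k. r (Suc k)) \<longlonglongrightarrow> 0"
      by (rule Lim_transform_eventually[OF lim]) (auto simp: step intro!: eventually_sequentiallyI[of 1])
    then have "r \<longlonglongrightarrow> 0" by (rule LIMSEQ_imp_Suc)
    then have "(\<lambda>k. r (n + k)) \<longlonglongrightarrow> 0" using LIMSEQ_ignore_initial_segment[of r 0 n] by (simp add: add.commute)
    from telescope_sums'[OF this] have "(\<lambda>k. luroth_width A (n + k)) sums r n"
      using width n by simp
    then show ?thesis unfolding luroth_tail_def by (rule sums_unique[symmetric])
  qed
  show "A n = {luroth_tail A (Suc n)<..luroth_tail A n}"
    using lr step tail assms(2) by simp
  show "luroth_width A n = luroth_tail A n - luroth_tail A (Suc n)"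
    using width tail assms(2) by simp
  show "0 < luroth_width A n" "0 < luroth_tail A n"
    using width[OF assms(2)] tail[OF assms(2)] lr[OF assms(2)] step[OF assms(2)] bnd[OF assms(2)]
    by auto
  show "luroth_tail A 1 = 1" using tail r1 by simp
qed

lemma luroth_index_in:
  assumes "luroth_partition A" and "y \<in> {0<..1}"
  shows "1 \<le> luroth_index A y \<and> y \<in> A (luroth_index A y)"
proof -
  have "(\<Union>n\<in>{1..}. A n) = {0<..1}"
    using assms(1) by (auto simp: luroth_partition_def partition_on_def)
  then obtain n where n: "1 \<le> n" "y \<in> A n" using assms(2) by blast
  moreover have "m = n" if "1 \<le> m" "y \<in> A m" for m
  proof (rule ccontr)
    have ord: "\<And>m n. 1 \<le> m \<Longrightarrow> m < n \<Longrightarrow> y \<in> A m \<Longrightarrow> y \<in> A n \<Longrightarrow> y < y"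
      using assms(1) unfolding luroth_partition_def by blast
    assume "m \<noteq> n"
    then show False using ord[of m n] ord[of n m] n that by (auto simp: neq_iff)
  qed
  ultimately have "\<exists>!n. 1 \<le> n \<and> y \<in> A n" by blast
  then show ?thesis unfolding luroth_index_def by (rule theI')
qed

text \<open>
  The digits and positions above do give the alternating expansion
  \<open>x = [l\<^sub>1, l\<^sub>2, \<dots>] = (\<Sum>k. (-1)^(k-1) (\<Prod>i<k. a(l\<^sub>i)) t(l\<^sub>k))\<close>.
\<close>

theorem luroth_expansion:
  assumes A: "luroth_partition A" and x: "x \<in> {0<..1}"
  shows "(\<lambda>k. if k \<in> luroth_positions A x
              then (- 1) ^ (k - 1) * (\<Prod>i\<in>{1..<k}. luroth_width A (luroth_digit A x i))
                     * luroth_tail A (luroth_digit A x k)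
              else 0) sums x"
proof -
  define t a where "t = luroth_tail A" and "a = luroth_width A"
  define z d where "z k = (luroth_map A ^^ k) x" and "d k = luroth_index A (z k)" for k
  note geo = luroth_partition_atoms[OF A, folded t_def a_def]
  have t_dec: "t n \<le> t m" if "1 \<le> m" "m \<le> n" for m n
    using that(2)
  proof (induction rule: dec_induct)
    case (step k)
    then show ?case using geo(2,3)[of k] that(1) by simp
  qed simp
  define c where "c = max (a 1) (t 2)"
  have c: "0 \<le> c" "c < 1" using geo[of 1] geo(2-4)[of 2] geo(4)[of 2]
    by (auto simp: c_def numeral_2_eq_2)
  have ac: "a n \<le> c" if "1 \<le> n" for n
  proof (cases "n = 1")
    case False
    then have "a n \<le> t n" using geo(2)[of n] geo(4)[of "Suc n"] that by auto
    also have "\<dots> \<le> t 2" using t_dec[of 2 n] False that by auto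
    finally show ?thesis by (simp add: c_def)
  qed (simp add: c_def)
  have map: "luroth_map A y \<in> {0..1} \<and> 1 \<le> luroth_index A y \<and>
      y = t (luroth_index A y) - a (luroth_index A y) * luroth_map A y \<and>
      (luroth_map A y = 0 \<longleftrightarrow> (\<exists>n\<ge>1. y = t n))"
    if y: "y \<in> {0<..1}" for y
  proof -
    define n where "n = luroth_index A y"
    have n: "1 \<le> n" "t (Suc n) < y" "y \<le> t n"
      using luroth_index_in[OF A y] geo(1)[of n] by (auto simp: n_def)
    have L: "luroth_map A y = (t n - y) / a n"
      using y by (simp add: luroth_map_def n_def t_def a_def)
    have eq: "y = t m \<Longrightarrow> m = n" if "1 \<le> m" for m
      using t_dec[of m n] t_dec[of "Suc n" m] n that geo(2,3)[of m] t_dec[of "Suc m" n]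
      by (cases m n rule: linorder_cases) auto
    show ?thesis
      using n geo(2,3)[OF n(1)] eq unfolding n_def[symmetric] L
      by (auto simp: divide_simps)
  qed
  have z0: "z 0 = x" by (simp add: z_def)
  have zS: "z (Suc k) = luroth_map A (z k)" for k by (simp add: z_def)
  have zr: "z k \<in> {0..1}" for k
  proof (induction k)
    case (Suc k)
    then show ?case using map[of "z k"] by (cases "z k = 0") (auto simp: zS luroth_map_def)
  qed (use x z0 in auto)
  have zpos: "z k \<noteq> 0 \<longleftrightarrow> (\<forall>j<k. \<forall>n\<ge>1. z j \<noteq> t n)" for k
  proof (induction k)
    case (Suc k)
    show ?case
    proof (cases "z k = 0")
      case True
      then show ?thesis using Suc by (auto simp: zS luroth_map_def less_Suc_eq)
    next
      case False
      then have "z k \<in> {0<..1}" using zr[of k] by auto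
      then have "z (Suc k) \<noteq> 0 \<longleftrightarrow> (\<forall>n\<ge>1. z k \<noteq> t n)" using map[of "z k"] by (auto simp: zS)
      then show ?thesis using Suc False by (auto simp: less_Suc_eq)
    qed
  qed (use x z0 in auto)
  have pos: "Suc k \<in> luroth_positions A x \<longleftrightarrow> z k \<noteq> 0" for k
  proof -
    have "(\<forall>j\<in>{1..<Suc k}. P (j - 1)) \<longleftrightarrow> (\<forall>j<k. P j)" for P
    proof -
      have "{..<k} = (\<lambda>j. j - 1) ` {1..<Suc k}" by (force simp: image_iff)
      then have "(\<forall>j\<in>{..<k}. P j) \<longleftrightarrow> (\<forall>j\<in>(\<lambda>j. j - 1) ` {1..<Suc k}. P j)" by (rule arg_cong)
      then show ?thesis by auto
    qed
    from this[of "\<lambda>j. \<forall>n\<ge>1. z j \<noteq> t n"] show ?thesis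
      unfolding zpos by (auto simp: luroth_positions_def z_def t_def)
  qed
  define p where "p k = (\<Prod>i<k. a (d i))" for k
  define s where "s k = (if z k \<noteq> 0 then (- 1) ^ k * p k * t (d k) else 0)" for k
  have part: "(\<Sum>k<m. s k) = x - (- 1) ^ m * p m * z m" for m
  proof (induction m)
    case (Suc m)
    show ?case
    proof (cases "z m = 0")
      case True
      then show ?thesis using Suc by (simp add: s_def zS luroth_map_def)
    next
      case False
      then have "z m \<in> {0<..1}" using zr[of m] by auto
      then have "z m = t (d m) - a (d m) * z (Suc m)" using map[of "z m"] by (simp add: zS d_def)
      then have "t (d m) = z m + a (d m) * z (Suc m)" by simp
      moreover have "(\<Sum>k<Suc m. s k) = x - (- 1) ^ m * p m * z m + (- 1) ^ m * p m * t (d m)"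
        unfolding sum.lessThan_Suc Suc using False by (simp add: s_def)
      moreover have "p (Suc m) = p m * a (d m)" by (simp add: p_def)
      ultimately show ?thesis by (simp add: algebra_simps)
    qed
  qed (simp add: p_def z0)
  have bound: "norm ((- 1) ^ m * p m * z m) \<le> c ^ m" for m
  proof (cases "z m = 0")
    case False
    have "0 \<le> a (d i) \<and> a (d i) \<le> c" if "i < m" for i
    proof -
      have "z i \<noteq> 0" using False that zpos[of m] zpos[of i] by auto
      then have "z i \<in> {0<..1}" using zr[of i] by auto
      then show ?thesis using map[of "z i"] geo(3) ac by (auto simp: d_def less_imp_le)
    qed
    then have "0 \<le> p m \<and> p m \<le> c ^ m"
      using prod_mono[of "{..<m}" "\<lambda>i. a (d i)" "\<lambda>_. c"] by (auto simp: p_def intro: prod_nonneg)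
    then show ?thesis using zr[of m] mult_mono[of "p m" "c ^ m" "z m" 1] c by (auto simp: abs_mult)
  qed (use c in simp)
  have "(\<lambda>m. c ^ m) \<longlonglongrightarrow> 0" using c by (intro LIMSEQ_power_zero) auto
  then have "(\<lambda>m. (- 1) ^ m * p m * z m) \<longlonglongrightarrow> 0"
    by (rule Lim_null_comparison[OF always_eventually[OF allI[OF bound]]])
  from tendsto_diff[OF tendsto_const[of x] this] have sx: "s sums x"
    unfolding sums_def part by simp
  have P: "(\<Prod>i\<in>{1..<Suc k}. luroth_width A (luroth_digit A x i)) = p k" for k
    unfolding p_def
    by (rule prod.reindex_bij_witness[of _ Suc "\<lambda>i. i - 1"])
       (auto simp: luroth_digit_def d_def z_def a_def)
  define f where "f k = (if k \<in> luroth_positions A x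
      then (- 1) ^ (k - 1) * (\<Prod>i\<in>{1..<k}. luroth_width A (luroth_digit A x i))
             * luroth_tail A (luroth_digit A x k) else 0)" for k
  have "f 0 = 0" by (simp add: f_def luroth_positions_def)
  moreover have "f (Suc k) = s k" for k
    unfolding f_def pos s_def P by (simp add: luroth_digit_def d_def z_def t_def)
  ultimately have "f sums x" using sums_Suc_iff[of f x] sx by simp
  then show ?thesis unfolding f_def .
qed

text \<open>
  Only the expansion generated by \<open>luroth_map\<close> is used.  The other finite expansion of the same
  point, \<open>[l\<^sub>1, \<dots>, l\<^sub>k - 1, 1]\<close>, yields the same value.
\<close>

definition farey_minkowski :: "(nat \<Rightarrow> real set) \<Rightarrow> real \<Rightarrow> real" where
  "farey_minkowski A x =
     (if x = 0 then 0
      else - 2 * (\<Sum>k. if k \<in> luroth_positions A x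
                       then (- 1) ^ k * (1 / 2) ^ (\<Sum>i = 1..k. luroth_digit A x i) else 0))"

text \<open>
  Derivatives of functions on \<open>[0,1]\<close>, with the value \<open>\<infinity>\<close> allowed; restricting the filter to
  \<open>[0,1]\<close> makes them one-sided at the endpoints.
\<close>

definition diff_quotient :: "(real \<Rightarrow> real) \<Rightarrow> real \<Rightarrow> real \<Rightarrow> ereal" where
  "diff_quotient f x y = ereal ((f y - f x) / (y - x))"

definition gen_deriv_exists :: "(real \<Rightarrow> real) \<Rightarrow> real \<Rightarrow> bool" where
  "gen_deriv_exists f x \<longleftrightarrow>
     (\<exists>D. D \<noteq> - \<infinity> \<and> (diff_quotient f x \<longlongrightarrow> D) (at x within {0..1}))"

definition gen_deriv :: "(real \<Rightarrow> real) \<Rightarrow> real \<Rightarrow> ereal" where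
  "gen_deriv f x = Lim (at x within {0..1}) (diff_quotient f x)"

end

theory Submission imports Defs begin

text \<open>
  On each atom, \<open>\<theta>\<close> is an affine copy of itself: \<open>\<theta> (t n - a n * u) = (2 - \<theta> u) / 2 ^ n\<close>.
  If \<open>\<theta>\<close> has a finite derivative \<open>D \<noteq> 0\<close> at \<open>x\<close>, rescaling \<open>\<theta>\<close> along the cylinders that shrink
  to \<open>x\<close> shows that \<open>s k * \<theta> u - D * u \<longlonglongrightarrow> 0\<close> for every \<open>u \<in> [0,1]\<close>, where \<open>s k\<close> is the slope
  of \<open>\<theta>\<close> over the \<open>k\<close>-th cylinder; \<open>u = 1\<close> gives \<open>s k \<longlonglongrightarrow> D\<close>, so \<open>\<theta> u = u\<close>.  If the expansion of
  \<open>x\<close> is finite, then \<open>x\<close> is an endpoint of a cylinder, and the atoms accumulating at \<open>0\<close>, carried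
  to \<open>x\<close>, play the same role.  But \<open>\<theta>\<close> is the identity only if \<open>t n = \<theta> (t n) = 2 / 2 ^ n\<close>,
  which is the dyadic case.
\<close>

locale luroth =
  fixes A :: "nat \<Rightarrow> real set"
  assumes partition: "luroth_partition A"
begin

abbreviation t :: "nat \<Rightarrow> real" where "t \<equiv> luroth_tail A"
abbreviation a :: "nat \<Rightarrow> real" where "a \<equiv> luroth_width A"
abbreviation L :: "real \<Rightarrow> real" where "L \<equiv> luroth_map A"
abbreviation idx :: "real \<Rightarrow> nat" where "idx \<equiv> luroth_index A"
abbreviation \<theta> :: "real \<Rightarrow> real" where "\<theta> \<equiv> farey_minkowski A"

lemmas atoms = luroth_partition_atoms[OF partition]
lemmas index_in = luroth_index_in[OF partition]

section \<open>Atoms, their endpoints and the inverse branches of \<open>L\<close>\<close>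

lemma atom_subset: "1 \<le> n \<Longrightarrow> A n \<subseteq> {0<..1}"
  using partition by (auto simp: luroth_partition_def partition_on_def)

lemma tail_mem: "1 \<le> n \<Longrightarrow> t n \<in> A n"
  using atoms[of n] by auto

lemma tail_antimono:
  assumes "1 \<le> m" "m \<le> n"
  shows "t n \<le> t m"
  using assms(2)
proof (induction rule: dec_induct)
  case (step k)
  then show ?case using atoms(2,3)[of k] assms(1) by simp
qed simp

lemma index_eq:
  assumes "1 \<le> n" "y \<in> A n"
  shows "idx y = n"
proof (rule ccontr)
  assume ne: "idx y \<noteq> n"
  have "1 \<le> idx y \<and> y \<in> A (idx y)"
    using index_in atom_subset assms by blast
  moreover have "\<And>m n. 1 \<le> m \<Longrightarrow> m < n \<Longrightarrow> y \<in> A m \<Longrightarrow> y \<in> A n \<Longrightarrow> y < y"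
    using partition unfolding luroth_partition_def by blast
  ultimately show False using assms ne by (metis less_irrefl linorder_neqE_nat)
qed

lemma tail_tendsto_0: "t \<longlonglongrightarrow> 0"
proof (rule LIMSEQ_I)
  fix e :: real assume "0 < e"
  define m where "m = idx (min e 1)"
  have m: "1 \<le> m" "min e 1 \<in> A m"
    using index_in[of "min e 1"] \<open>0 < e\<close> by (auto simp: m_def)
  then have "t (Suc m) < e" using atoms(1)[of m] by auto
  then have "norm (t n - 0) < e" if "n \<ge> Suc m" for n
    using tail_antimono[of "Suc m" n] atoms(4)[of n] that by auto
  then show "\<exists>no. \<forall>n\<ge>no. norm (t n - 0) < e" by blast
qed

lemma branch_mem:
  assumes "1 \<le> n" "u \<in> {0..1}"
  shows "t n - a n * u \<in> {t (Suc n)..t n}" "t n - a n * u \<in> {0<..1}"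
proof -
  have "0 \<le> a n * u" "a n * u \<le> a n" using assms atoms(3)[of n] by (auto simp: mult_left_le)
  then show "t n - a n * u \<in> {t (Suc n)..t n}" using atoms(2)[of n] assms by auto
  then show "t n - a n * u \<in> {0<..1}"
    using atoms(4)[of "Suc n"] tail_antimono[of 1 n] atoms(5) assms by auto
qed

lemma map_0: "L 0 = 0"
  by (simp add: luroth_map_def)

lemma map_eq:
  assumes "y \<in> A n" "1 \<le> n"
  shows "L y = (t n - y) / a n"
  using index_eq[OF assms(2,1)] atom_subset[OF assms(2)] assms(1) by (auto simp: luroth_map_def)

lemma map_branch:
  assumes "y \<in> {0<..1}"
  shows "L y \<in> {0..1}" "y = t (idx y) - a (idx y) * L y"
    "L y = 0 \<longleftrightarrow> (\<exists>n\<ge>1. y = t n)"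
proof -
  have n: "1 \<le> idx y" "y \<in> A (idx y)" using index_in[OF assms] by auto
  note L = map_eq[OF n(2,1)]
  show "L y \<in> {0..1}" "y = t (idx y) - a (idx y) * L y"
    using n atoms[OF n(1)] unfolding L by (auto simp: divide_simps)
  have "L y = 0 \<longleftrightarrow> y = t (idx y)" using atoms(3)[OF n(1)] unfolding L by auto
  also have "\<dots> \<longleftrightarrow> (\<exists>n\<ge>1. y = t n)" using n(1) index_eq tail_mem by metis
  finally show "L y = 0 \<longleftrightarrow> (\<exists>n\<ge>1. y = t n)" .
qed

lemma map_mem: "y \<in> {0..1} \<Longrightarrow> L y \<in> {0..1}"
  using map_branch(1)[of y] map_0 by (cases "y = 0") auto

lemma iterate_mem: "y \<in> {0..1} \<Longrightarrow> (L ^^ k) y \<in> {0..1}"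
  by (induction k) (auto simp del: atLeastAtMost_iff intro: map_mem)

lemma iterate_index:
  assumes "y \<in> {0..1}" "(L ^^ k) y \<noteq> 0"
  shows "1 \<le> idx ((L ^^ k) y)"
proof -
  have "(L ^^ k) y \<in> {0<..1}" using iterate_mem[OF assms(1), of k] assms(2) by auto
  then show ?thesis using index_in by blast
qed

section \<open>The series of \<theta> and its functional equation\<close>

lemma position_Suc_0: "Suc 0 \<in> luroth_positions A y"
  by (simp add: luroth_positions_def)

lemma position_Suc_Suc:
  "Suc (Suc k) \<in> luroth_positions A y \<longleftrightarrow>
     (\<forall>n\<ge>1. y \<noteq> t n) \<and> Suc k \<in> luroth_positions A (L y)"
proof -
  \<comment> \<open>Positions count from 1, iterates of \<open>L\<close> from 0;
    \<open>shift\<close> translates between the two.\<close>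
  have shift: "(\<forall>j\<in>{1..<Suc m}. P (j - 1)) \<longleftrightarrow> (\<forall>j<m. P j)" for P and m :: nat
  proof -
    have "{..<m} = (\<lambda>j. j - 1) ` {1..<Suc m}" by (force simp: image_iff)
    then have "(\<forall>j\<in>{..<m}. P j) \<longleftrightarrow> (\<forall>j\<in>(\<lambda>j. j - 1) ` {1..<Suc m}. P j)" by (rule arg_cong)
    then show ?thesis by auto
  qed
  have pos: "Suc m \<in> luroth_positions A w \<longleftrightarrow> (\<forall>j<m. \<forall>n\<ge>1. (L ^^ j) w \<noteq> t n)" for m w
    using shift[of m "\<lambda>j. \<forall>n\<ge>1. (L ^^ j) w \<noteq> t n"] by (simp add: luroth_positions_def)
  show ?thesis
    unfolding pos by (auto simp: All_less_Suc2 funpow_swap1)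
qed

text \<open>A position is reached only while no earlier iterate is some \<open>t n\<close>, and on
  \<open>(0,1]\<close> these are the only zeros of \<open>L\<close>. Hence digits at positions are
  indices of points of \<open>(0,1]\<close>, never the unspecified
  \<open>luroth_index A 0\<close>.\<close>

lemma position_iterate_nonzero:
  assumes "y \<in> {0<..1}" "Suc k \<in> luroth_positions A y"
  shows "(L ^^ k) y \<noteq> 0"
  using assms
proof (induction k arbitrary: y)
  case (Suc k)
  have "L y \<noteq> 0" using Suc.prems map_branch(3) position_Suc_Suc by blast
  then have "L y \<in> {0<..1}" using map_branch(1)[OF Suc.prems(1)] by auto
  then show ?case using Suc.IH[of "L y"] Suc.prems(2) by (simp add: position_Suc_Suc funpow_swap1)
qed auto

lemma position_downward:
  assumes "k \<in> luroth_positions A y" "1 \<le> j" "j \<le> k"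
  shows "j \<in> luroth_positions A y"
  using assms by (auto simp: luroth_positions_def)

definition fm_term :: "real \<Rightarrow> nat \<Rightarrow> real" where
  "fm_term y k = (if k \<in> luroth_positions A y
     then (- 1) ^ k * (1 / 2) ^ (\<Sum>i = 1..k. luroth_digit A y i) else 0)"

text \<open>Every digit at a position is at least 1, so the exponent of the \<open>k\<close>-th term
  is at least \<open>k\<close> and a geometric series dominates.\<close>

lemma summable_fm_term:
  assumes "y \<in> {0<..1}"
  shows "summable (fm_term y)"
proof (rule summable_comparison_test'[of "\<lambda>k. (1 / 2) ^ k" 0])
  fix k
  show "norm (fm_term y k) \<le> (1 / 2) ^ k"
  proof (cases "k \<in> luroth_positions A y")
    case True
    have "1 \<le> luroth_digit A y i" if i: "i \<in> {1..k}" for i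
    proof -
      have "Suc (i - 1) \<in> luroth_positions A y"
        using position_downward[OF True, of i] i by auto
      then have "(L ^^ (i - 1)) y \<noteq> 0" using position_iterate_nonzero[OF assms] by blast
      then show ?thesis using iterate_index[of y "i - 1"] assms by (simp add: luroth_digit_def)
    qed
    then have "(\<Sum>i = 1..k. 1) \<le> (\<Sum>i = 1..k. luroth_digit A y i)" by (rule sum_mono)
    then have "k \<le> (\<Sum>i = 1..k. luroth_digit A y i)" by simp
    then have "(1 / 2 :: real) ^ (\<Sum>i = 1..k. luroth_digit A y i) \<le> (1 / 2) ^ k"
      by (intro power_decreasing) auto
    then show ?thesis using True by (simp add: fm_term_def abs_mult)
  qed (simp add: fm_term_def)
qed (simp add: summable_geometric)

lemma fm_0: "\<theta> 0 = 0"
  by (simp add: farey_minkowski_def)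

text \<open>Passing from \<open>y\<close> to \<open>L y\<close> deletes the first digit. After its
  first term, the series of \<open>y\<close> is therefore that of \<open>L y\<close> multiplied by
  \<open>- ((1 / 2) ^ idx y)\<close>.\<close>

lemma fm_rec:
  assumes y: "y \<in> {0<..1}"
  shows "\<theta> y = (2 - \<theta> (L y)) / 2 ^ idx y"
proof -
  have fm: "\<theta> w = - 2 * (\<Sum>k. fm_term w k)" if "w \<noteq> 0" for w
    using that by (simp add: farey_minkowski_def fm_term_def)
  have term0: "fm_term w 0 = 0" for w by (simp add: fm_term_def luroth_positions_def)
  have term1: "fm_term y 1 = - ((1 / 2) ^ idx y)"
    using position_Suc_0 by (simp add: fm_term_def luroth_digit_def)
  have split: "(\<Sum>k. fm_term w k) = (\<Sum>k. fm_term w (Suc k))" if "w \<in> {0<..1}" for w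
    using suminf_split_head[OF summable_fm_term[OF that]] term0 by simp
  have "(\<Sum>k. fm_term y k) = (\<Sum>k. fm_term y (Suc k))" using split y .
  also have "\<dots> = fm_term y 1 + (\<Sum>k. fm_term y (Suc (Suc k)))"
    using suminf_split_head[of "\<lambda>k. fm_term y (Suc k)"] summable_fm_term[OF y] by (simp add: summable_Suc_iff)
  also have "(\<Sum>k. fm_term y (Suc (Suc k))) = (1 / 2) ^ idx y * (\<theta> (L y) / 2)"
  \<comment> \<open>\<open>\<theta> 0\<close> is fixed by convention and not by the series, so
    one-digit expansions are treated apart.\<close>
  proof (cases "L y = 0")
    case True
    then have "fm_term y (Suc (Suc k)) = 0" for k
      using map_branch(3)[OF y] position_Suc_Suc by (auto simp: fm_term_def)
    then show ?thesis using True by (simp add: fm_0)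
  next
    case False
    then have Ly: "L y \<in> {0<..1}" using map_branch(1)[OF y] by auto
    have digits: "(\<Sum>i = 1..Suc (Suc k). luroth_digit A y i)
        = idx y + (\<Sum>i = 1..Suc k. luroth_digit A (L y) i)" for k
    proof -
      have "(\<Sum>i = 1..Suc (Suc k). luroth_digit A y i)
          = luroth_digit A y 1 + (\<Sum>i = Suc 1..Suc (Suc k). luroth_digit A y i)"
        by (simp add: sum.atLeast_Suc_atMost)
      also have "(\<Sum>i = Suc 1..Suc (Suc k). luroth_digit A y i)
          = (\<Sum>i = 1..Suc k. luroth_digit A y (Suc i))"
        by (rule sum.shift_bounds_cl_Suc_ivl)
      also have "\<dots> = (\<Sum>i = 1..Suc k. luroth_digit A (L y) i)"
      proof (rule sum.cong)
        fix i assume "i \<in> {1..Suc k}"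
        then obtain j where "i = Suc j" by (cases i) auto
        then show "luroth_digit A y (Suc i) = luroth_digit A (L y) i"
          by (simp add: luroth_digit_def funpow_swap1)
      qed simp
      finally show ?thesis by (simp add: luroth_digit_def)
    qed
    have "Suc (Suc k) \<in> luroth_positions A y \<longleftrightarrow> Suc k \<in> luroth_positions A (L y)" for k
      using False map_branch(3)[OF y] position_Suc_Suc by blast
    then have "fm_term y (Suc (Suc k)) = - ((1 / 2) ^ idx y) * fm_term (L y) (Suc k)" for k
      unfolding fm_term_def digits by (simp add: power_add)
    then have "(\<Sum>k. fm_term y (Suc (Suc k))) = - ((1 / 2) ^ idx y) * (\<Sum>k. fm_term (L y) (Suc k))"
      using suminf_mult[of "\<lambda>k. fm_term (L y) (Suc k)" "- ((1 / 2) ^ idx y)"] summable_fm_term[OF Ly]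
      by (simp add: summable_Suc_iff)
    then show ?thesis using fm[OF False] split[OF Ly] by simp
  qed
  finally show ?thesis using y fm[of y] term1 by (simp add: field_simps power_divide)
qed

lemma fm_tail:
  assumes "1 \<le> n"
  shows "\<theta> (t n) = 2 / 2 ^ n"
proof -
  have "L (t n) = 0" using map_eq[OF tail_mem] assms by simp
  moreover have "t n \<in> {0<..1}" using atom_subset[OF assms] tail_mem[OF assms] by blast
  ultimately show ?thesis
    using fm_rec index_eq[OF assms tail_mem[OF assms]] by (simp add: fm_0)
qed

lemma fm_1: "\<theta> 1 = 1"
  using fm_tail[of 1] atoms(5)[of 1] by simp

text \<open>For \<open>u < 1\<close> this is \<open>fm_rec\<close> read along the inverse branch. At
  \<open>u = 1\<close> the point is \<open>t (Suc n)\<close>, which lies in the next atom; the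
  formula persists because the two finite expansions of that point give the same value.\<close>

lemma fm_branch:
  assumes n: "1 \<le> n" and u: "u \<in> {0..1}"
  shows "\<theta> (t n - a n * u) = (2 - \<theta> u) / 2 ^ n"
proof (cases "u = 1")
  case True
  then have "t n - a n * u = t (Suc n)" using atoms(2)[OF n] by simp
  then show ?thesis using True fm_tail[of "Suc n"] by (simp add: fm_1)
next
  case False
  let ?y = "t n - a n * u"
  have "a n * u < a n" using False u atoms(3)[OF n] by simp
  then have y: "?y \<in> A n" using branch_mem[OF n u] atoms(1,2)[OF n] by auto
  have "L ?y = u" using map_eq[OF y n] atoms(3)[OF n] by simp
  then show ?thesis using fm_rec[OF branch_mem(2)[OF n u]] index_eq[OF n y] by simp
qed

lemma dyadic_if_fm_id:
  assumes "\<And>u. u \<in> {0..1} \<Longrightarrow> \<theta> u = u"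
  shows "dyadic A"
proof -
  have t: "t n = 2 / 2 ^ n" if "1 \<le> n" for n
    using assms[of "t n"] fm_tail[OF that] tail_mem[OF that] atom_subset[OF that] by force
  have "A n = {1 / 2 ^ n <.. 1 / 2 ^ (n - 1)}" if "n \<in> {1..}" for n
    using atoms(1)[of n] t[of n] t[of "Suc n"] that by (cases n) auto
  then show ?thesis unfolding dyadic_def by (rule image_cong[OF refl])
qed

section \<open>Rescaling \<theta> along the orbit of a fixed point \<open>x\<close>\<close>

context
  fixes x :: real
  assumes x: "x \<in> {0..1}"
begin

abbreviation z :: "nat \<Rightarrow> real" where "z k \<equiv> (L ^^ k) x"

text \<open>Signed slope of the inverse branch of \<open>L ^^ k\<close> through \<open>x\<close>, a
  composition of maps \<open>u \<mapsto> t n - a n * u\<close>. Correspondingly, \<open>Q k\<close>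
  is the slope of the composed maps \<open>v \<mapsto> (2 - v) / 2 ^ n\<close> acting on values of
  \<theta>.\<close>

definition q :: "nat \<Rightarrow> real" where "q k = (\<Prod>i<k. - a (idx (z i)))"
definition Q :: "nat \<Rightarrow> real" where "Q k = (\<Prod>i<k. - (1 / 2 ^ idx (z i)))"

lemma Q_nonzero: "Q k \<noteq> 0"
  by (simp add: Q_def)

lemma q_nonzero:
  assumes "\<forall>j<k. z j \<noteq> 0"
  shows "q k \<noteq> 0"
  using atoms(3) iterate_index[OF x] assms by (fastforce simp: q_def)

text \<open>
  The point \<open>x + q k * (u - z k)\<close> is the image of \<open>u\<close> under the inverse branch of \<open>L ^^ k\<close> that
  sends \<open>z k\<close> to \<open>x\<close>.
\<close>

lemma fm_cylinder:
  assumes "\<forall>j<k. z j \<noteq> 0" "u \<in> {0..1}"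
  shows "x + q k * (u - z k) \<in> {0..1} \<and>
         \<theta> (x + q k * (u - z k)) = \<theta> x + Q k * (\<theta> u - \<theta> (z k))"
  using assms
proof (induction k arbitrary: u)
  case 0
  then show ?case by (simp add: q_def Q_def)
next
  case (Suc k)
  \<comment> \<open>The innermost branch moves \<open>u\<close> to \<open>?v\<close>, in the closure
    of the atom of \<open>z k\<close>; the induction hypothesis then applies to
    \<open>?v\<close>.\<close>
  let ?n = "idx (z k)" and ?v = "t (idx (z k)) - a (idx (z k)) * u"
  have n: "1 \<le> ?n" using iterate_index[OF x] Suc.prems by simp
  have zk: "z k \<in> {0<..1}" using iterate_mem[OF x, of k] Suc.prems(1) by auto
  have v: "?v \<in> {0..1}" using branch_mem(2)[OF n Suc.prems(2)] by auto
  have "?v - z k = - a ?n * (u - z (Suc k))" using map_branch(2)[OF zk] by (simp add: algebra_simps)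
  then have "q (Suc k) * (u - z (Suc k)) = q k * (?v - z k)"
    by (simp add: q_def)
  moreover have "\<theta> ?v - \<theta> (z k) = - (1 / 2 ^ ?n) * (\<theta> u - \<theta> (z (Suc k)))"
    unfolding fm_branch[OF n Suc.prems(2)] fm_rec[OF zk] by (simp add: field_simps)
  then have "Q (Suc k) * (\<theta> u - \<theta> (z (Suc k))) = Q k * (\<theta> ?v - \<theta> (z k))"
    by (simp add: Q_def)
  ultimately show ?case using Suc.IH[OF _ v] Suc.prems(1) by simp
qed

text \<open>All widths are bounded by one constant below 1: an atom other than the first lies below
  \<open>t 2\<close>, so its width is at most \<open>t 2 < 1\<close>, and
  \<open>a 1 = 1 - t 2 < 1\<close>.\<close>

lemma q_tendsto_0:
  assumes "\<forall>j. z j \<noteq> 0"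
  shows "q \<longlonglongrightarrow> 0"
proof -
  define c where "c = max (a 1) (t 2)"
  have c: "0 \<le> c" "c < 1" using atoms(2-5)[of 1] atoms(2-4)[of 2]
    by (auto simp: c_def numeral_2_eq_2)
  have ac: "a n \<le> c" if "1 \<le> n" for n
  proof (cases "n = 1")
    case False
    then have "a n \<le> t n" using atoms(2)[of n] atoms(4)[of "Suc n"] that by auto
    also have "\<dots> \<le> t 2" using tail_antimono[of 2 n] False that by auto
    finally show ?thesis by (simp add: c_def)
  qed (simp add: c_def)
  have idx: "1 \<le> idx (z i)" for i using iterate_index[OF x] assms by simp
  have bound: "norm (q k) \<le> c ^ k" for k
    using prod_mono[of "{..<k}" "\<lambda>i. \<bar>a (idx (z i))\<bar>" "\<lambda>_. c"] ac[OF idx] atoms(3)[OF idx]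
    by (simp add: q_def abs_prod less_imp_le)
  have "(\<lambda>k. c ^ k) \<longlonglongrightarrow> 0" using c by (intro LIMSEQ_power_zero) auto
  then show ?thesis
    by (rule Lim_null_comparison[OF always_eventually[OF allI[OF bound]]])
qed

lemma fm_id_if_derivative_infinite:
  assumes D: "(\<theta> has_real_derivative D) (at x within {0..1})" "D \<noteq> 0"
    and z: "\<forall>j. z j \<noteq> 0" and u: "u \<in> {0..1}"
  shows "\<theta> u = u"
proof -
  define s where "s k = Q k / q k" for k
  \<comment> \<open>Since \<open>v\<close> and \<open>z k\<close> lie in \<open>[0,1]\<close>, the
    linearisation error at \<open>x + q k * (v - z k)\<close> is small relative to
    \<open>q k\<close>, and dividing by \<open>q k\<close> leaves a null sequence.\<close>
  have lim: "(\<lambda>k. s k * (\<theta> v - \<theta> (z k)) - D * (v - z k)) \<longlonglongrightarrow> 0" if v: "v \<in> {0..1}" for v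
  proof (rule LIMSEQ_I)
    fix e :: real assume e: "0 < e"
    have "0 < e / 2" using e by simp
    then obtain d where d: "d > 0"
      "\<And>y. y \<in> {0..1} \<Longrightarrow> norm (y - x) < d \<Longrightarrow>
         norm (\<theta> y - \<theta> x - D * (y - x)) \<le> e / 2 * norm (y - x)"
      using D(1) unfolding has_field_derivative_def has_derivative_within_alt by blast
    obtain N where N: "\<And>k. k \<ge> N \<Longrightarrow> norm (q k - 0) < d"
      using LIMSEQ_D[OF q_tendsto_0[OF z] d(1)] by blast
    have "norm (s k * (\<theta> v - \<theta> (z k)) - D * (v - z k) - 0) < e" if k: "k \<ge> N" for k
    proof -
      define y where "y = x + q k * (v - z k)"
      have y: "y \<in> {0..1}" "\<theta> y - \<theta> x = Q k * (\<theta> v - \<theta> (z k))" "y - x = q k * (v - z k)"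
        using fm_cylinder[of k v] z v by (auto simp: y_def)
      have qk: "q k \<noteq> 0" using q_nonzero z by blast
      have "\<bar>v - z k\<bar> \<le> 1" using v iterate_mem[OF x, of k] by auto
      then have yx: "\<bar>y - x\<bar> \<le> \<bar>q k\<bar>" unfolding y(3) by (simp add: abs_mult mult_left_le)
      then have "\<bar>\<theta> y - \<theta> x - D * (y - x)\<bar> \<le> e / 2 * \<bar>y - x\<bar>"
        using d(2)[OF y(1)] N[OF k] by simp
      also have "\<dots> \<le> e / 2 * \<bar>q k\<bar>" using yx e by (intro mult_left_mono) auto
      also have "\<theta> y - \<theta> x - D * (y - x)
          = q k * (s k * (\<theta> v - \<theta> (z k)) - D * (v - z k))"
        unfolding y(2,3) s_def using qk by (simp add: field_simps)
      finally have "\<bar>s k * (\<theta> v - \<theta> (z k)) - D * (v - z k)\<bar> \<le> e / 2"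
        using qk by (simp add: abs_mult mult.commute)
      then show ?thesis using e by simp
    qed
    then show "\<exists>no. \<forall>k\<ge>no. norm (s k * (\<theta> v - \<theta> (z k)) - D * (v - z k) - 0) < e" by blast
  qed
  \<comment> \<open>Subtracting the case \<open>v = 0\<close> removes \<open>z k\<close>, whose
    convergence is unknown.\<close>
  have lim0: "(\<lambda>k. s k * \<theta> v - D * v) \<longlonglongrightarrow> 0" if "v \<in> {0..1}" for v
    using tendsto_diff[OF lim[OF that] lim[of 0]] by (simp add: fm_0 algebra_simps)
  have "s \<longlonglongrightarrow> D" using lim0[of 1] by (simp add: fm_1 LIM_zero_iff)
  then have "(\<lambda>k. s k * \<theta> u - D * u) \<longlonglongrightarrow> D * \<theta> u - D * u" by (intro tendsto_intros)
  from LIMSEQ_unique[OF lim0[OF u] this] show ?thesis using D(2) by auto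
qed

lemma fm_id_if_derivative_finite:
  assumes D: "(\<theta> has_real_derivative D) (at x within {0..1})" "D \<noteq> 0"
    and z: "\<exists>j. z j = 0" and u: "u \<in> {0..1}"
  shows "\<theta> u = u"
proof -
  \<comment> \<open>The inverse branch of order \<open>m\<close> sends 0 to \<open>x\<close>; for
    \<open>x = 0\<close> it is the identity, with \<open>m = 0\<close>.\<close>
  define m where "m = (LEAST j. z j = 0)"
  have zm: "z m = 0" unfolding m_def using z by (rule LeastI_ex)
  have zj: "\<forall>j<m. z j \<noteq> 0" using not_less_Least m_def by blast
  note qm = q_nonzero[OF zj]
  \<comment> \<open>The limit of \<open>w / \<theta> w\<close> as \<open>w\<close> tends to 0 along
    points of the atoms, carried to \<open>x\<close> by the branch of order
    \<open>m\<close>.\<close>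
  define c where "c = Q m / (D * q m)"
  have c: "c \<noteq> 0" using Q_nonzero D(2) qm by (simp add: c_def)
  have lim: "(\<lambda>n. (2 ^ Suc n * t (Suc n) - 2 ^ Suc n * a (Suc n) * v) / (2 - \<theta> v)) \<longlonglongrightarrow> c"
    if v: "v \<in> {0..1}" for v
  proof -
    define w where "w n = t (Suc n) - a (Suc n) * v" for n
    have w: "w n \<in> {0<..1}" "w n \<le> t (Suc n)" for n
      using branch_mem[OF _ v, of "Suc n"] by (auto simp: w_def)
    have w0: "w \<longlonglongrightarrow> 0"
      by (rule tendsto_sandwich[OF _ _ tendsto_const LIMSEQ_Suc[OF tail_tendsto_0]])
         (use w in \<open>auto simp: less_imp_le\<close>)
    define y where "y n = x + q m * w n" for n
    have y: "y n \<in> {0..1}" "\<theta> (y n) - \<theta> x = Q m * \<theta> (w n)" for n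
      using fm_cylinder[OF zj, of "w n"] w(1)[of n] by (auto simp: y_def zm fm_0)
    have "y \<longlonglongrightarrow> x + q m * 0" unfolding y_def using w0 by (intro tendsto_intros)
    then have "filterlim y (at x within {0..1}) sequentially"
      using y(1) w(1) qm by (auto simp: filterlim_at y_def less_le)
    then have "(\<lambda>n. (\<theta> (y n) - \<theta> x) / (y n - x)) \<longlonglongrightarrow> D"
      using D(1) unfolding has_field_derivative_iff by (rule filterlim_compose[rotated])
    \<comment> \<open>The difference quotient is inverted so that \<open>v\<close> enters the
      numerator linearly; \<open>v = 0\<close> and \<open>v = 1\<close> then determine the limits of
      the two coefficients.\<close>
    then have "(\<lambda>n. (Q m / q m) / ((\<theta> (y n) - \<theta> x) / (y n - x))) \<longlonglongrightarrow> (Q m / q m) / D"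
      using D(2) by (intro tendsto_intros)
    moreover have "(Q m / q m) / ((\<theta> (y n) - \<theta> x) / (y n - x))
        = (2 ^ Suc n * t (Suc n) - 2 ^ Suc n * a (Suc n) * v) / (2 - \<theta> v)" for n
    proof -
      have "(Q m / q m) / ((\<theta> (y n) - \<theta> x) / (y n - x)) = w n / \<theta> (w n)"
        unfolding y(2) using qm Q_nonzero[of m] by (simp add: y_def)
      also have "\<theta> (w n) = (2 - \<theta> v) / 2 ^ Suc n" using fm_branch[OF _ v] by (simp add: w_def)
      finally show ?thesis by (simp add: w_def algebra_simps)
    qed
    ultimately show ?thesis by (simp add: c_def field_simps)
  qed
  have t: "(\<lambda>n. 2 ^ Suc n * t (Suc n)) \<longlonglongrightarrow> 2 * c"
    using tendsto_mult[OF tendsto_const[of 2] lim[of 0]] by (simp add: fm_0 mult.assoc)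
  have "(\<lambda>n. 2 ^ Suc n * t (Suc n) - 2 ^ Suc n * a (Suc n)) \<longlonglongrightarrow> c"
    using lim[of 1] by (simp add: fm_1)
  from tendsto_diff[OF t this] have a: "(\<lambda>n. 2 ^ Suc n * a (Suc n)) \<longlonglongrightarrow> c" by simp
  have "(\<lambda>n. (2 ^ Suc n * t (Suc n) - 2 ^ Suc n * a (Suc n) * u) / (2 - \<theta> u))
      \<longlonglongrightarrow> (2 * c - c * u) / (2 - \<theta> u)"
    unfolding divide_inverse by (intro tendsto_intros t a)
  from LIMSEQ_unique[OF this lim[OF u]] have "(2 * c - c * u) / (2 - \<theta> u) = c" .
  \<comment> \<open>Besides allowing cancellation, \<open>c \<noteq> 0\<close> excludes
    \<open>\<theta> u = 2\<close>, where the quotient would be 0 by the convention on division by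
    zero.\<close>
  then show ?thesis using c by (auto simp: divide_simps algebra_simps split: if_splits)
qed

lemma fm_id_if_derivative:
  assumes "(\<theta> has_real_derivative D) (at x within {0..1})" "D \<noteq> 0" "u \<in> {0..1}"
  shows "\<theta> u = u"
  using assms fm_id_if_derivative_infinite fm_id_if_derivative_finite by blast

end

end

theorem proposition3p4:
  fixes A :: "nat \<Rightarrow> real set" and x :: real
  assumes "luroth_partition A"
    and "\<not> dyadic A"
    and "x \<in> {0..1}"
    and "gen_deriv_exists (farey_minkowski A) x"
  shows "gen_deriv (farey_minkowski A) x \<in> {0, \<infinity>}"
proof -
  interpret luroth A by unfold_locales (rule assms(1))
  obtain D where D: "D \<noteq> - \<infinity>" "(diff_quotient \<theta> x \<longlongrightarrow> D) (at x within {0..1})"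
    using assms(4) unfolding gen_deriv_exists_def by blast
  \<comment> \<open>No point of \<open>[0,1]\<close> is isolated, so the limit is unique and
    \<open>Lim\<close> returns it.\<close>
  have "at x within {0..1} \<noteq> bot"
    using assms(3) connected_imp_perfect[of "{0..1::real}" x] connected_Icc[of 0 "1::real"]
    by (auto simp: trivial_limit_within)
  then have "gen_deriv \<theta> x = D"
    unfolding gen_deriv_def using D(2) by (rule tendsto_Lim)
  moreover have "D = 0" if r: "D = ereal r" for r
  proof (rule ccontr)
    assume "D \<noteq> 0"
    then have "r \<noteq> 0" using r by simp
    moreover have "(\<theta> has_real_derivative r) (at x within {0..1})"
      using D(2) unfolding r has_field_derivative_iff diff_quotient_def[abs_def] by simp
    ultimately have "dyadic A"
      using fm_id_if_derivative[OF assms(3)] by (intro dyadic_if_fm_id) blast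
    then show False using assms(2) by blast
  qed
  ultimately show ?thesis using D(1) by (cases D) auto
qed

end
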